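(* Let $M$ be a compact, connected $n$-dimensional Riemannian manifold with Riemannian distance $d$, and let $\bar V$ be its Riemannian volume measure normalized to be a probability measure. Let $(P_i)_{i\ge1}$ be an i.i.d. sequence of $M$-valued random variables with law $\bar V$, and let $\mu^N=\frac1N\sum_{i=1}^N\delta_{P_i}$. Then $W_1(\mu^N,\bar V)\to0$ almost surely as $N\to\infty$.
   Context: $W_1(\mu,\nu)=\sup_f\{\int_M f\,d\mu-\int_M f\,d\nu\}$ is the Kantorovich distance, the supremum being over functions $f:M\to\mathbb{R}$ that are Lipschitz with respect to $d$ with Lipschitz constant at most $1$. *)

theory Defs
  imports "HOL-Probability.Probability"
begin

section \<open>Smooth maps on open subsets of normed spaces\<close>

text \<open>Intended for open sets \<open>S\<close> of a finite-dimensional space, where testing the derivative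
  on each fixed direction \<open>v\<close> amounts to the usual condition on partial derivatives.\<close>

primrec Ck_on :: "nat \<Rightarrow> ('b::real_normed_vector \<Rightarrow> 'c::real_normed_vector) \<Rightarrow> 'b set \<Rightarrow> bool" where
  "Ck_on 0 f S \<longleftrightarrow> continuous_on S f"
| "Ck_on (Suc k) f S \<longleftrightarrow>
     (\<forall>x\<in>S. f differentiable (at x)) \<and> (\<forall>v. Ck_on k (\<lambda>x. frechet_derivative f (at x) v) S)"

definition smooth_on :: "('b::real_normed_vector \<Rightarrow> 'c::real_normed_vector) \<Rightarrow> 'b set \<Rightarrow> bool" where
  "smooth_on f S \<longleftrightarrow> (\<forall>k. Ck_on k f S)"


section \<open>Riemannian manifolds\<close>

text \<open>A chart is a pair of a domain and a coordinate map; the values of the coordinate map outside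
  the domain are irrelevant. A manifold is an abstract topology \<open>X\<close> with a smooth atlas \<open>A\<close>
  (not assumed maximal).\<close>

type_synonym ('a, 'n) chart = "'a set \<times> ('a \<Rightarrow> real ^ 'n)"

abbreviation chart_image :: "('a, 'n::finite) chart \<Rightarrow> (real ^ 'n) set" where
  "chart_image c \<equiv> snd c ` fst c"

definition transition :: "('a, 'n::finite) chart \<Rightarrow> ('a, 'n) chart \<Rightarrow> real ^ 'n \<Rightarrow> real ^ 'n" where
  "transition c c' = snd c' \<circ> inv_into (fst c) (snd c)"

locale smooth_manifold =
  fixes X :: "'a topology"
    and A :: "('a, 'n::finite) chart set"
  assumes Hausdorff: "Hausdorff_space X"
    and second_countable: "second_countable X"
    and chart_domain_open: "c \<in> A \<Longrightarrow> openin X (fst c)"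
    and chart_image_open: "c \<in> A \<Longrightarrow> open (chart_image c)"
    and chart_homeomorphism:
      "c \<in> A \<Longrightarrow> homeomorphic_map (subtopology X (fst c)) (top_of_set (chart_image c)) (snd c)"
    and charts_cover: "(\<Union>c\<in>A. fst c) = topspace X"
    and transition_smooth:
      "c \<in> A \<Longrightarrow> c' \<in> A \<Longrightarrow> smooth_on (transition c c') (snd c ` (fst c \<inter> fst c'))"

text \<open>The metric tensor is given by its component matrices: \<open>g c x\<close> is the matrix \<open>(g\<^sub>i\<^sub>j)\<close> in the
  chart \<open>c\<close> at the coordinate point \<open>x\<close>. The last axiom is the transformation law of a
  covariant 2-tensor.\<close>

locale riemannian_manifold = smooth_manifold X A
  for X :: "'a topology" and A :: "('a, 'n::finite) chart set" +
  fixes g :: "('a, 'n) chart \<Rightarrow> real ^ 'n \<Rightarrow> real ^ 'n ^ 'n"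
  assumes metric_smooth: "c \<in> A \<Longrightarrow> smooth_on (g c) (chart_image c)"
    and metric_symmetric: "c \<in> A \<Longrightarrow> x \<in> chart_image c \<Longrightarrow> transpose (g c x) = g c x"
    and metric_positive:
      "c \<in> A \<Longrightarrow> x \<in> chart_image c \<Longrightarrow> v \<noteq> 0 \<Longrightarrow> v \<bullet> (g c x *v v) > 0"
    and metric_compatible:
      "c \<in> A \<Longrightarrow> c' \<in> A \<Longrightarrow> x \<in> snd c ` (fst c \<inter> fst c') \<Longrightarrow>
        u \<bullet> (g c x *v v) =
          frechet_derivative (transition c c') (at x) u \<bullet>
            (g c' (transition c c' x) *v frechet_derivative (transition c c') (at x) v)"


section \<open>Riemannian distance\<close>

text \<open>\<open>C\<^sup>1\<close> on the closed interval, with one-sided derivatives at the end points. The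
  derivative is required to extend continuously to the end points, so the speed is bounded.\<close>

definition C1_curve_on ::
    "'a topology \<Rightarrow> ('a, 'n::finite) chart set \<Rightarrow> real \<Rightarrow> real \<Rightarrow> (real \<Rightarrow> 'a) \<Rightarrow> bool" where
  "C1_curve_on X A a b \<gamma> \<longleftrightarrow>
     continuous_map (top_of_set {a..b}) X \<gamma> \<and>
     (\<forall>c\<in>A. \<exists>D. continuous_on {t\<in>{a..b}. \<gamma> t \<in> fst c} D \<and>
        (\<forall>t\<in>{a..b}. \<gamma> t \<in> fst c \<longrightarrow>
           ((snd c \<circ> \<gamma>) has_vector_derivative D t) (at t within {a..b})))"

text \<open>\<open>S\<close> is the set of subdivision points of \<open>[0,1]\<close>; \<open>a\<close> and \<open>b\<close> range over consecutive ones.\<close>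

definition piecewise_C1_curve ::
    "'a topology \<Rightarrow> ('a, 'n::finite) chart set \<Rightarrow> (real \<Rightarrow> 'a) \<Rightarrow> bool" where
  "piecewise_C1_curve X A \<gamma> \<longleftrightarrow>
     pathin X \<gamma> \<and>
     (\<exists>S. finite S \<and> {0, 1} \<subseteq> S \<and> S \<subseteq> {0..1} \<and>
        (\<forall>a\<in>S. \<forall>b\<in>S. a < b \<and> S \<inter> {a<..<b} = {} \<longrightarrow> C1_curve_on X A a b \<gamma>))"

text \<open>The speed is computed in an arbitrary chart around \<open>\<gamma> t\<close>. Where \<open>\<gamma>\<close> is \<open>C\<^sup>1\<close>, that is,
  off finitely many times, it does not depend on this choice, by the transformation law.\<close>

definition curve_speed ::
    "('a, 'n::finite) chart set \<Rightarrow> (('a, 'n) chart \<Rightarrow> real ^ 'n \<Rightarrow> real ^ 'n ^ 'n) \<Rightarrow>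
     (real \<Rightarrow> 'a) \<Rightarrow> real \<Rightarrow> real" where
  "curve_speed A g \<gamma> t =
     (let c = (SOME c. c \<in> A \<and> \<gamma> t \<in> fst c);
          v = vector_derivative (snd c \<circ> \<gamma>) (at t)
      in sqrt (v \<bullet> (g c (snd c (\<gamma> t)) *v v)))"

definition curve_length ::
    "('a, 'n::finite) chart set \<Rightarrow> (('a, 'n) chart \<Rightarrow> real ^ 'n \<Rightarrow> real ^ 'n ^ 'n) \<Rightarrow>
     (real \<Rightarrow> 'a) \<Rightarrow> real" where
  "curve_length A g \<gamma> = integral {0..1} (curve_speed A g \<gamma>)"

text \<open>A real infimum: on a connected manifold the set of admissible curves is never empty.\<close>

definition riemannian_dist ::
    "'a topology \<Rightarrow> ('a, 'n::finite) chart set \<Rightarrow>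
     (('a, 'n) chart \<Rightarrow> real ^ 'n \<Rightarrow> real ^ 'n ^ 'n) \<Rightarrow> 'a \<Rightarrow> 'a \<Rightarrow> real" where
  "riemannian_dist X A g p q =
     Inf {curve_length A g \<gamma> | \<gamma>. piecewise_C1_curve X A \<gamma> \<and> \<gamma> 0 = p \<and> \<gamma> 1 = q}"


section \<open>Riemannian volume\<close>

definition borel_measure_space :: "'a topology \<Rightarrow> 'a measure" where
  "borel_measure_space X = sigma (topspace X) {U. openin X U}"

text \<open>\<open>V\<close> is the Borel measure given in every chart by \<open>\<surd>(det (g\<^sub>i\<^sub>j)) dx\<^sup>1 \<dots> dx\<^sup>n\<close>. Since
  countably many chart domains cover the manifold, this determines \<open>V\<close>.\<close>

definition is_riemannian_volume ::
    "'a topology \<Rightarrow> ('a, 'n::finite) chart set \<Rightarrow>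
     (('a, 'n) chart \<Rightarrow> real ^ 'n \<Rightarrow> real ^ 'n ^ 'n) \<Rightarrow> 'a measure \<Rightarrow> bool" where
  "is_riemannian_volume X A g V \<longleftrightarrow>
     space V = topspace X \<and> sets V = sets (borel_measure_space X) \<and>
     (\<forall>c\<in>A. \<forall>B\<in>sets V. B \<subseteq> fst c \<longrightarrow>
        emeasure V B = (\<integral>\<^sup>+x\<in>snd c ` B. ennreal (sqrt (det (g c x))) \<partial>lborel))"

definition normalized_measure :: "'a measure \<Rightarrow> 'a measure" where
  "normalized_measure V = scale_measure (inverse (emeasure V (space V))) V"


section \<open>Empirical measures and the Kantorovich distance\<close>

definition empirical_measure :: "'a measure \<Rightarrow> (nat \<Rightarrow> 'a) \<Rightarrow> nat \<Rightarrow> 'a measure" where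
  "empirical_measure M p N =
     measure_of (space M) (sets M) (\<lambda>B. (\<Sum>i=1..N. emeasure (return M (p i)) B) / of_nat N)"

text \<open>The supremum is taken in \<open>ereal\<close>, so that it is meaningful without a boundedness proof.\<close>

definition kantorovich_dist ::
    "'a set \<Rightarrow> ('a \<Rightarrow> 'a \<Rightarrow> real) \<Rightarrow> 'a measure \<Rightarrow> 'a measure \<Rightarrow> ereal" where
  "kantorovich_dist M d \<mu> \<nu> =
     (SUP f\<in>{f :: 'a \<Rightarrow> real. \<forall>x\<in>M. \<forall>y\<in>M. \<bar>f x - f y\<bar> \<le> d x y}.
        ereal ((LINT x|\<mu>. f x) - (LINT x|\<nu>. f x)))"

end

(*
  The two geometric facts needed are that the Riemannian distance is nonnegative and that every point
  has arbitrarily d-small neighbourhoods; the latter holds because coordinate segments in a small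
  chart ball are short. By compactness M splits into finitely many Borel pieces of d-diameter at
  most e, and by connectedness all 1-Lipschitz functions have oscillation bounded by a common K.
  Replacing f by a step function then bounds W_1(mu^N, V) by 2 e + K * (sum over the pieces of
  |mu^N(B) - V(B)|), uniformly in f, and the sum tends to 0 almost surely: for a fixed B, Hoeffding's
  inequality and the Borel-Cantelli lemma give the strong law for the indicators of B.
*)
theory Submission
  imports Defs
begin

section \<open>Piecewise \<open>C\<^sup>1\<close> curves and the Riemannian distance\<close>

text \<open>The difficulty is the order of quantifiers: one null set must serve all 1-Lipschitz
  functions, an uncountable family. Randomness therefore enters only through the measures of sets
  fixed before the outcome: one finite Borel partition for each fineness \<open>1 / Suc k\<close>, a
  countable family in all, so that the null sets of the strong law can be united. The constant K
  must be common to all f as well; it is found from the Lipschitz functions themselves, with the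
  triangle inequality applied to their real values. Small neighbourhoods serve a further purpose:
  they make every 1-Lipschitz function continuous for the topology \<open>X\<close>, hence Borel
  measurable and, being bounded, integrable. Connectedness is used a second time, for the distance:
  the infimum defining it must range over a nonempty set, which is obtained by joining short
  coordinate segments.\<close>

lemma C1_curve_on_cong:
  assumes "C1_curve_on X A a b \<gamma>" and "\<And>t. t \<in> {a..b} \<Longrightarrow> \<gamma> t = \<delta> t"
  shows "C1_curve_on X A a b \<delta>"
  unfolding C1_curve_on_def
proof (intro conjI ballI)
  show "continuous_map (top_of_set {a..b}) X \<delta>"
    using assms unfolding C1_curve_on_def by (auto intro: continuous_map_eq)
next
  fix c assume "c \<in> A"
  then obtain D where D: "continuous_on {t\<in>{a..b}. \<gamma> t \<in> fst c} D"
    "\<And>t. t \<in> {a..b} \<Longrightarrow> \<gamma> t \<in> fst c \<Longrightarrow> ((snd c \<circ> \<gamma>) has_vector_derivative D t) (at t within {a..b})"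
    using assms(1) unfolding C1_curve_on_def by blast
  have eq: "{t\<in>{a..b}. \<delta> t \<in> fst c} = {t\<in>{a..b}. \<gamma> t \<in> fst c}"
    using assms(2) by auto
  show "\<exists>D. continuous_on {t\<in>{a..b}. \<delta> t \<in> fst c} D \<and>
        (\<forall>t\<in>{a..b}. \<delta> t \<in> fst c \<longrightarrow>
           ((snd c \<circ> \<delta>) has_vector_derivative D t) (at t within {a..b}))"
  proof (intro exI[of _ D] conjI ballI impI)
    show "continuous_on {t\<in>{a..b}. \<delta> t \<in> fst c} D"
      using D(1) eq by simp
  next
    fix t assume t: "t \<in> {a..b}" "\<delta> t \<in> fst c"
    then show "((snd c \<circ> \<delta>) has_vector_derivative D t) (at t within {a..b})"
      using D(2)[of t] assms(2)
      by (intro has_vector_derivative_transform[of t "{a..b}" "snd c \<circ> \<delta>" "snd c \<circ> \<gamma>" "D t"]) auto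
  qed
qed

text \<open>The chain rule, with new derivative \<open>m *\<^sub>R D (m * t + k)\<close>. Slope 2 is
  the case of interest: each of two joined curves is run at double speed on one half of
  [0,1].\<close>

lemma C1_curve_on_affine:
  assumes \<gamma>: "C1_curve_on X A a' b' \<gamma>" and m: "m > 0"
    and a': "a' = m * a + k" and b': "b' = m * b + k"
  shows "C1_curve_on X A a b (\<lambda>t. \<gamma> (m * t + k))"
  unfolding C1_curve_on_def
proof (intro conjI ballI)
  have im: "(\<lambda>t. m * t + k) ` {a..b} \<subseteq> {a'..b'}"
    using m by (auto simp: a' b')
  have "continuous_map (top_of_set {a..b}) (top_of_set {a'..b'}) (\<lambda>t. m * t + k)"
    using im by (auto intro!: continuous_intros simp: continuous_map_in_subtopology)
  then have "continuous_map (top_of_set {a..b}) X (\<gamma> \<circ> (\<lambda>t. m * t + k))"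
    by (rule continuous_map_compose) (use \<gamma> in \<open>simp add: C1_curve_on_def\<close>)
  then show "continuous_map (top_of_set {a..b}) X (\<lambda>t. \<gamma> (m * t + k))"
    by (simp add: o_def)
  fix c assume "c \<in> A"
  then obtain D where D: "continuous_on {t\<in>{a'..b'}. \<gamma> t \<in> fst c} D"
    "\<And>t. t \<in> {a'..b'} \<Longrightarrow> \<gamma> t \<in> fst c \<Longrightarrow> ((snd c \<circ> \<gamma>) has_vector_derivative D t) (at t within {a'..b'})"
    using \<gamma> unfolding C1_curve_on_def by blast
  show "\<exists>D. continuous_on {t\<in>{a..b}. \<gamma> (m * t + k) \<in> fst c} D \<and>
        (\<forall>t\<in>{a..b}. \<gamma> (m * t + k) \<in> fst c \<longrightarrow>
           ((snd c \<circ> (\<lambda>t. \<gamma> (m * t + k))) has_vector_derivative D t) (at t within {a..b}))"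
  proof (intro exI[of _ "\<lambda>t. m *\<^sub>R D (m * t + k)"] conjI ballI impI)
    show "continuous_on {t\<in>{a..b}. \<gamma> (m * t + k) \<in> fst c} (\<lambda>t. m *\<^sub>R D (m * t + k))"
      by (intro continuous_intros continuous_on_compose2[OF D(1)]) (use im in blast)
  next
    fix t assume t: "t \<in> {a..b}" "\<gamma> (m * t + k) \<in> fst c"
    have "((\<lambda>t. m * t + k) has_vector_derivative m) (at t within {a..b})"
      by (auto intro!: derivative_eq_intros)
    moreover have "((snd c \<circ> \<gamma>) has_vector_derivative D (m * t + k)) (at (m * t + k) within (\<lambda>t. m * t + k) ` {a..b})"
      by (rule has_vector_derivative_within_subset[OF D(2) im]) (use t im in blast)+
    ultimately have "(snd c \<circ> \<gamma> \<circ> (\<lambda>t. m * t + k) has_vector_derivative m *\<^sub>R D (m * t + k)) (at t within {a..b})"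
      by (rule vector_diff_chain_within)
    then show "((snd c \<circ> (\<lambda>t. \<gamma> (m * t + k))) has_vector_derivative m *\<^sub>R D (m * t + k)) (at t within {a..b})"
      by (simp add: o_def)
  qed
qed

lemma piecewise_C1_curveE:
  assumes "piecewise_C1_curve X A \<gamma>"
  obtains S where "finite S" "{0, 1} \<subseteq> S" "S \<subseteq> {0..1}"
    "\<And>a b. a \<in> S \<Longrightarrow> b \<in> S \<Longrightarrow> a < b \<Longrightarrow> S \<inter> {a<..<b} = {} \<Longrightarrow> C1_curve_on X A a b \<gamma>"
proof -
  obtain S where S: "finite S" "{0, 1} \<subseteq> S" "S \<subseteq> {0..1}"
    and C1: "\<forall>a\<in>S. \<forall>b\<in>S. a < b \<and> S \<inter> {a<..<b} = {} \<longrightarrow> C1_curve_on X A a b \<gamma>"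
    using assms unfolding piecewise_C1_curve_def by (elim conjE exE)
  show thesis
    by (rule that[OF S]) (use C1 in simp)
qed

lemma piecewise_C1_curve_join:
  assumes 1: "piecewise_C1_curve X A \<gamma>1" and 2: "piecewise_C1_curve X A \<gamma>2" and eq: "\<gamma>1 1 = \<gamma>2 0"
  shows "piecewise_C1_curve X A (\<lambda>t. if t \<le> 1/2 then \<gamma>1 (2 * t) else \<gamma>2 (2 * t - 1))"
    (is "piecewise_C1_curve X A ?h")
proof -
  obtain S1 where S1: "finite S1" "{0, 1} \<subseteq> S1" "S1 \<subseteq> {0..1}"
    "\<And>a b. a \<in> S1 \<Longrightarrow> b \<in> S1 \<Longrightarrow> a < b \<Longrightarrow> S1 \<inter> {a<..<b} = {} \<Longrightarrow> C1_curve_on X A a b \<gamma>1"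
    using 1 by (rule piecewise_C1_curveE) blast
  obtain S2 where S2: "finite S2" "{0, 1} \<subseteq> S2" "S2 \<subseteq> {0..1}"
    "\<And>a b. a \<in> S2 \<Longrightarrow> b \<in> S2 \<Longrightarrow> a < b \<Longrightarrow> S2 \<inter> {a<..<b} = {} \<Longrightarrow> C1_curve_on X A a b \<gamma>2"
    using 2 by (rule piecewise_C1_curveE) blast
  \<comment> \<open>Both subdivisions are squeezed into the halves of [0,1]. The point 1/2 belongs
    to \<open>S\<close>, as the image of 1 from \<open>S1\<close> and of 0 from \<open>S2\<close>,
    so no two consecutive points straddle it.\<close>
  define S where "S = (\<lambda>s. s / 2) ` S1 \<union> (\<lambda>s. (s + 1) / 2) ` S2"
  \<comment> \<open>A point of \<open>S\<close> in the left half that comes from \<open>S2\<close>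
    can only be 1/2, whose double is the end point 1 of \<open>S1\<close>; \<open>half2\<close> is
    the mirror case.\<close>
  have half1: "2 * a \<in> S1" if "a \<in> S" "a \<le> 1/2" for a
  proof -
    consider s where "s \<in> S1" "a = s / 2" | s where "s \<in> S2" "a = (s + 1) / 2"
      using \<open>a \<in> S\<close> unfolding S_def by blast
    then show ?thesis
    proof cases
      case (2 s)
      then have "s \<ge> 0" using S2(3) by auto
      then have "2 * a = 1" using 2(2) \<open>a \<le> 1/2\<close> by simp
      then show ?thesis using S1(2) by simp
    qed (auto simp: field_simps)
  qed
  have half2: "2 * a - 1 \<in> S2" if "a \<in> S" "a \<ge> 1/2" for a
  proof -
    consider s where "s \<in> S1" "a = s / 2" | s where "s \<in> S2" "a = (s + 1) / 2"
      using \<open>a \<in> S\<close> unfolding S_def by blast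
    then show ?thesis
    proof cases
      case (1 s)
      then have "s \<le> 1" using S1(3) by auto
      then have "2 * a - 1 = 0" using 1(2) \<open>a \<ge> 1/2\<close> by simp
      then show ?thesis using S2(2) by simp
    qed (auto simp: field_simps)
  qed
  have p: "pathin X \<gamma>1" "pathin X \<gamma>2"
    using 1 2 by (auto simp: piecewise_C1_curve_def)
  have "continuous_map (top_of_set {0..1}) X ?h"
  proof (rule continuous_map_cases_le)
    have "continuous_map (top_of_set ({0..1} \<inter> {..1/2})) X (\<gamma>1 \<circ> (\<lambda>t. 2 * t))"
      by (rule continuous_map_compose[OF _ p(1)[unfolded pathin_def]])
        (auto intro!: continuous_intros simp: continuous_map_in_subtopology)
    moreover have "{x \<in> topspace (top_of_set {0..1::real}). x \<le> 1/2} = {0..1} \<inter> {..1/2}" by auto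
    ultimately show "continuous_map (subtopology (top_of_set {0..1}) {x \<in> topspace (top_of_set {0..1}). x \<le> 1/2}) X (\<lambda>t. \<gamma>1 (2 * t))"
      by (simp add: o_def subtopology_subtopology)
    have "continuous_map (top_of_set ({0..1} \<inter> {1/2..})) X (\<gamma>2 \<circ> (\<lambda>t. 2 * t - 1))"
      by (rule continuous_map_compose[OF _ p(2)[unfolded pathin_def]])
        (auto intro!: continuous_intros simp: continuous_map_in_subtopology)
    moreover have "{x \<in> topspace (top_of_set {0..1::real}). 1/2 \<le> x} = {0..1} \<inter> {1/2..}" by auto
    ultimately show "continuous_map (subtopology (top_of_set {0..1}) {x \<in> topspace (top_of_set {0..1}). 1/2 \<le> x}) X (\<lambda>t. \<gamma>2 (2 * t - 1))"
      by (simp add: o_def subtopology_subtopology)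
    show "\<gamma>1 (2 * t) = \<gamma>2 (2 * t - 1)" if t: "t = 1/2" for t
      unfolding t using eq by simp
  qed simp_all
  then have "pathin X ?h" by (simp add: pathin_def)
  moreover have "C1_curve_on X A a b ?h" if ab: "a \<in> S" "b \<in> S" "a < b" "S \<inter> {a<..<b} = {}" for a b
  proof -
    have "1/2 \<in> S" using S1 unfolding S_def by auto
    then consider "b \<le> 1/2" | "a \<ge> 1/2" using ab by fastforce
    then show ?thesis
    proof cases
      case 1
      have "s \<notin> {2*a<..<2*b}" if "s \<in> S1" for s
      proof -
        have "s / 2 \<in> S" using that by (auto simp: S_def)
        then have "s / 2 \<notin> {a<..<b}" using ab by blast
        then show ?thesis by auto
      qed
      then have "S1 \<inter> {2*a<..<2*b} = {}" by blast
      then have "C1_curve_on X A (2 * a) (2 * b) \<gamma>1"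
        using S1(4)[OF half1 half1] ab 1 by auto
      then have "C1_curve_on X A a b (\<lambda>t. \<gamma>1 (2 * t + 0))"
        by (rule C1_curve_on_affine) simp_all
      then show ?thesis
        by (rule C1_curve_on_cong) (use 1 in auto)
    next
      case 2
      have "s \<notin> {2*a-1<..<2*b-1}" if "s \<in> S2" for s
      proof -
        have "(s + 1) / 2 \<in> S" using that by (auto simp: S_def)
        then have "(s + 1) / 2 \<notin> {a<..<b}" using ab by blast
        then show ?thesis by auto
      qed
      then have "S2 \<inter> {2*a-1<..<2*b-1} = {}" by blast
      then have "C1_curve_on X A (2 * a - 1) (2 * b - 1) \<gamma>2"
        using S2(4)[OF half2 half2] ab 2 by auto
      then have "C1_curve_on X A a b (\<lambda>t. \<gamma>2 (2 * t + -1))"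
        by (rule C1_curve_on_affine) simp_all
      then show ?thesis
      proof (rule C1_curve_on_cong)
        fix t assume t: "t \<in> {a..b}"
        show "\<gamma>2 (2 * t + -1) = ?h t"
        proof (cases "t = 1/2")
          case True
          show ?thesis unfolding True using eq by simp
        qed (use t 2 in auto)
      qed
    qed
  qed
  moreover have "finite S" "{0, 1} \<subseteq> S" "S \<subseteq> {0..1}"
    using S1(1-3) S2(1-3) unfolding S_def by (auto simp: image_iff)
  ultimately show ?thesis
    unfolding piecewise_C1_curve_def by blast
qed

section \<open>Short curves, connectedness by curves, and nonnegativity of the distance\<close>

context riemannian_manifold
begin

lemma curve_speed_nonneg:
  assumes "\<gamma> t \<in> topspace X"
  shows "curve_speed A g \<gamma> t \<ge> 0"
proof -
  define c where "c = (SOME c. c \<in> A \<and> \<gamma> t \<in> fst c)"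
  have "\<exists>c. c \<in> A \<and> \<gamma> t \<in> fst c"
    using assms charts_cover by blast
  then have c: "c \<in> A \<and> \<gamma> t \<in> fst c"
    unfolding c_def by (rule someI_ex)
  define v where "v = vector_derivative (snd c \<circ> \<gamma>) (at t)"
  have "v \<bullet> (g c (snd c (\<gamma> t)) *v v) \<ge> 0"
    using metric_positive[of c "snd c (\<gamma> t)" v] c by (cases "v = 0") (auto intro: less_imp_le)
  then show ?thesis
    unfolding curve_speed_def Let_def c_def[symmetric] v_def[symmetric] by simp
qed

lemma curve_length_nonneg:
  assumes "piecewise_C1_curve X A \<gamma>"
  shows "curve_length A g \<gamma> \<ge> 0"
proof -
  have "\<gamma> t \<in> topspace X" if "t \<in> {0..1}" for t
    using assms that path_image_subset_topspace unfolding piecewise_C1_curve_def by blast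
  then have "curve_speed A g \<gamma> t \<ge> 0" if "t \<in> {0..1}" for t
    using that by (intro curve_speed_nonneg)
  \<comment> \<open>The value of \<open>integral\<close> is 0 when the speed is not integrable, so
    the sign is clear in that case too.\<close>
  then show ?thesis
    unfolding curve_length_def
    by (cases "curve_speed A g \<gamma> integrable_on {0..1}")
      (auto intro: integral_nonneg simp: not_integrable_integral)
qed

text \<open>The squared speed of a coordinate segment is a function of position and velocity that is
  continuous and vanishes at velocity 0, hence is below \<open>\<epsilon>\<^sup>2\<close> for
  positions near that of \<open>p\<close> and small velocities. All ordered pairs in
  \<open>U\<close> are covered, not only those starting at \<open>p\<close>: this bounds the
  diameter of \<open>U\<close> and gives curves in both directions.\<close>

lemma small_chart_segments:
  assumes p: "p \<in> topspace X" and \<epsilon>: "\<epsilon> > 0"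
  shows "\<exists>U. openin X U \<and> p \<in> U \<and>
    (\<forall>x\<in>U. \<forall>y\<in>U. \<exists>\<gamma>. piecewise_C1_curve X A \<gamma> \<and> \<gamma> 0 = x \<and> \<gamma> 1 = y \<and> curve_length A g \<gamma> \<le> \<epsilon>)"
proof -
  obtain c where c: "c \<in> A" "p \<in> fst c" using p charts_cover by blast
  define \<phi> where "\<phi> = snd c"
  define \<psi> where "\<psi> = inv_into (fst c) \<phi>"
  define T where "T = chart_image c"
  have dom: "fst c \<subseteq> topspace X" using chart_domain_open[OF c(1)] by (rule openin_subset)
  have hom: "homeomorphic_map (subtopology X (fst c)) (top_of_set T) \<phi>"
    using chart_homeomorphism[OF c(1)] by (simp add: \<phi>_def T_def)
  have inj: "inj_on \<phi> (fst c)"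
    using homeomorphic_imp_injective_map[OF hom] dom by (simp add: inf.absorb2)
  have \<psi>: "\<psi> (\<phi> x) = x" if "x \<in> fst c" for x
    using inj that by (simp add: \<psi>_def)
  have \<psi>T: "\<psi> z \<in> fst c" "\<phi> (\<psi> z) = z" if "z \<in> T" for z
    using that by (auto simp: \<psi>_def T_def \<phi>_def inv_into_into f_inv_into_f)
  \<comment> \<open>\<open>homeomorphic_map\<close> only provides some continuous inverse
    \<open>\<psi>'\<close>; injectivity of the chart identifies it on \<open>T\<close> with
    \<open>inv_into\<close>, the inverse that occurs in \<open>transition\<close>.\<close>
  have "continuous_map (top_of_set T) (subtopology X (fst c)) \<psi>"
  proof -
    obtain \<psi>' where \<psi>': "homeomorphic_maps (subtopology X (fst c)) (top_of_set T) \<phi> \<psi>'"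
      using hom homeomorphic_map_maps by blast
    then have cont: "continuous_map (top_of_set T) (subtopology X (fst c)) \<psi>'"
      and inv: "\<And>z. z \<in> T \<Longrightarrow> \<phi> (\<psi>' z) = z"
      by (auto simp: homeomorphic_maps_def)
    have "\<psi>' z = \<psi> z" if "z \<in> T" for z
    proof -
      have "\<psi>' z \<in> fst c"
        using cont that by (fastforce simp: continuous_map_def)
      then show ?thesis using \<psi>[of "\<psi>' z"] inv[OF that] by simp
    qed
    then show ?thesis by (auto intro: continuous_map_eq[OF cont])
  qed
  then have \<psi>_cont: "continuous_map (top_of_set T) X \<psi>"
    by (simp add: continuous_map_in_subtopology)
  have openT: "open T" using chart_image_open[OF c(1)] by (simp add: T_def)
  define z0 where "z0 = \<phi> p"
  have z0: "z0 \<in> T" using c by (auto simp: z0_def T_def \<phi>_def)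
  define F where "F = (\<lambda>zv. snd zv \<bullet> (g c (fst zv) *v snd zv))"
  have "Ck_on 0 (g c) T"
    using metric_smooth[OF c(1)] unfolding smooth_on_def T_def by blast
  then have gc: "continuous_on T (g c)" by simp
  have "continuous_on (T \<times> UNIV) F"
    unfolding F_def matrix_vector_mult_def
    by (intro continuous_intros continuous_on_compose2[OF gc]) auto
  then have "isCont F (z0, 0)"
    using openT z0 by (simp add: continuous_on_eq_continuous_at open_Times)
  then have "F \<midarrow>(z0, 0)\<rightarrow> F (z0, 0)" by (simp add: isCont_def)
  moreover have "F (z0, 0) = 0" by (simp add: F_def)
  ultimately have "eventually (\<lambda>w. dist (F w) 0 < \<epsilon>\<^sup>2) (at (z0, 0))"
    using \<epsilon> tendstoD[of F 0 "at (z0,0)" "\<epsilon>\<^sup>2"] by simp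
  then obtain d1 where d1: "d1 > 0" "\<And>w. dist w (z0, 0) < d1 \<Longrightarrow> w \<noteq> (z0,0) \<Longrightarrow> \<bar>F w\<bar> < \<epsilon>\<^sup>2"
    unfolding eventually_at by auto
  have Fsmall: "\<bar>F w\<bar> < \<epsilon>\<^sup>2" if "dist w (z0, 0) < d1" for w
    using d1(2)[OF that] \<open>F (z0, 0) = 0\<close> \<epsilon> by (cases "w = (z0, 0)") auto
  obtain d2 where d2: "d2 > 0" "ball z0 d2 \<subseteq> T"
    using openT z0 open_contains_ball by blast
  \<comment> \<open>Along a segment in the ball of radius \<open>r\<close> the position stays within
    \<open>r\<close> of \<open>z0\<close> and the velocity has norm below \<open>2 * r\<close>, so
    the pair is within \<open>3 * r\<close>, hence within \<open>d1\<close>, of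
    \<open>(z0, 0)\<close>; \<open>d2\<close> keeps the ball inside the chart image.\<close>
  define r where "r = min d2 (d1 / 3)"
  have r: "r > 0" "ball z0 r \<subseteq> T" using d1 d2 by (auto simp: r_def)
  define U where "U = {x \<in> fst c. \<phi> x \<in> ball z0 r}"
  have "openin (subtopology X (fst c)) {x \<in> topspace (subtopology X (fst c)). \<phi> x \<in> T \<inter> ball z0 r}"
    by (rule openin_continuous_map_preimage[OF homeomorphic_imp_continuous_map[OF hom]])
      (auto intro: openin_open_Int)
  also have "{x \<in> topspace (subtopology X (fst c)). \<phi> x \<in> T \<inter> ball z0 r} = U"
    using dom r by (auto simp: U_def)
  finally have "openin X U"
    using chart_domain_open[OF c(1)] openin_trans_full by blast
  moreover have "p \<in> U" using c r by (simp add: U_def z0_def)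
  moreover have "\<exists>\<gamma>. piecewise_C1_curve X A \<gamma> \<and> \<gamma> 0 = x \<and> \<gamma> 1 = y \<and> curve_length A g \<gamma> \<le> \<epsilon>"
    if x: "x \<in> U" and y: "y \<in> U" for x y
  proof -
    define v where "v = \<phi> y - \<phi> x"
    define l where "l = (\<lambda>t::real. \<phi> x + t *\<^sub>R v)"
    define \<gamma> where "\<gamma> = (\<lambda>t. \<psi> (l t))"
    have lb: "l t \<in> ball z0 r" if "t \<in> {0..1}" for t
    proof -
      have "(1 - t) *\<^sub>R \<phi> x + t *\<^sub>R \<phi> y \<in> ball z0 r"
        using x y that convexD_alt[OF convex_ball, of "\<phi> x" z0 r "\<phi> y" t] by (auto simp: U_def)
      then show ?thesis by (simp add: l_def v_def algebra_simps)
    qed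
    then have lT: "l t \<in> T" if "t \<in> {0..1}" for t using that r by blast
    have lc: "continuous_on S l" for S
      unfolding l_def by (intro continuous_intros)
    have lder: "(l has_vector_derivative v) (at t)" for t
      unfolding l_def by (auto intro!: derivative_eq_intros)
    have \<gamma>c: "continuous_map (top_of_set {0..1}) X \<gamma>"
    proof -
      have "continuous_map (top_of_set {0..1}) X (\<psi> \<circ> l)"
        by (rule continuous_map_compose[OF _ \<psi>_cont])
          (use lT lc in \<open>auto simp: continuous_map_in_subtopology\<close>)
      then show ?thesis by (simp add: \<gamma>_def o_def)
    qed
    have overlap: "l t \<in> snd c ` (fst c \<inter> fst c')" if "t \<in> {0..1}" "\<gamma> t \<in> fst c'" for t c'
      using that \<psi>T[OF lT[OF that(1)]] unfolding \<gamma>_def \<phi>_def by (metis IntI imageI)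
    \<comment> \<open>In every chart the curve is a transition map after an affine function;
      first-order smoothness of the transition maps gives its derivative and the continuity of that
      derivative.\<close>
    have comp: "snd c' \<circ> \<gamma> = transition c c' \<circ> l" for c'
      by (auto simp: transition_def \<gamma>_def \<psi>_def \<phi>_def)
    have sm: "Ck_on (Suc 0) (transition c c') (snd c ` (fst c \<inter> fst c'))" if "c' \<in> A" for c'
      using transition_smooth[OF c(1) that] unfolding smooth_on_def by blast
    \<comment> \<open>The derivative is two-sided even at 0 and 1, because \<open>l\<close> is
      affine on the whole line and \<open>comp\<close> is an identity of functions. This matters
      since \<open>curve_speed\<close> differentiates at \<open>t\<close> without restriction to
      [0,1].\<close>
    have der: "((snd c' \<circ> \<gamma>) has_vector_derivative frechet_derivative (transition c c') (at (l t)) v) (at t)"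
      if "c' \<in> A" "t \<in> {0..1}" "\<gamma> t \<in> fst c'" for c' t
    proof -
      have "transition c c' differentiable (at (l t))"
        using sm[OF that(1)] overlap[OF that(2,3)] unfolding Ck_on.simps by blast
      then have "(transition c c' has_derivative frechet_derivative (transition c c') (at (l t))) (at (l t))"
        using frechet_derivative_works by blast
      then have "(transition c c' has_derivative frechet_derivative (transition c c') (at (l t))) (at (l t) within range l)"
        by (rule has_derivative_at_withinI)
      then show ?thesis
        using vector_derivative_diff_chain_within[OF lder] unfolding comp by blast
    qed
    have "C1_curve_on X A 0 1 \<gamma>"
      unfolding C1_curve_on_def
    proof (intro conjI ballI \<gamma>c)
      fix c' assume c': "c' \<in> A"
      show "\<exists>D. continuous_on {t\<in>{0..1}. \<gamma> t \<in> fst c'} D \<and>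
        (\<forall>t\<in>{0..1}. \<gamma> t \<in> fst c' \<longrightarrow>
           ((snd c' \<circ> \<gamma>) has_vector_derivative D t) (at t within {0..1}))"
      proof (intro exI[of _ "\<lambda>t. frechet_derivative (transition c c') (at (l t)) v"] conjI ballI impI)
        have "continuous_on (snd c ` (fst c \<inter> fst c')) (\<lambda>x. frechet_derivative (transition c c') (at x) v)"
          using sm[OF c'] by simp
        then show "continuous_on {t \<in> {0..1}. \<gamma> t \<in> fst c'} (\<lambda>t. frechet_derivative (transition c c') (at (l t)) v)"
          by (rule continuous_on_compose2[OF _ lc]) (use overlap in blast)
      next
        fix t :: real assume "t \<in> {0..1}" "\<gamma> t \<in> fst c'"
        then show "((snd c' \<circ> \<gamma>) has_vector_derivative frechet_derivative (transition c c') (at (l t)) v) (at t within {0..1})"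
          using der[OF c'] has_vector_derivative_at_within by blast
      qed
    qed
    then have "piecewise_C1_curve X A \<gamma>"
      unfolding piecewise_C1_curve_def pathin_def
      by (intro conjI \<gamma>c exI[of _ "{0,1}"]) auto
    moreover have "\<gamma> 0 = x" "\<gamma> 1 = y"
      using x y \<psi> by (auto simp: \<gamma>_def l_def v_def U_def)
    moreover have "curve_length A g \<gamma> \<le> \<epsilon>"
    proof -
      have "curve_speed A g \<gamma> t \<le> \<epsilon>" if t: "t \<in> {0..1}" for t
      proof -
        \<comment> \<open>\<open>curve_speed\<close> picks its chart by \<open>SOME\<close>,
          possibly a different one at each \<open>t\<close>; the transformation law brings the speed
          back to the fixed chart \<open>c\<close>, as \<open>sqrt (F (l t, v))\<close>.\<close>
        define c' where "c' = (SOME c. c \<in> A \<and> \<gamma> t \<in> fst c)"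
        have "\<gamma> t \<in> fst c" using \<psi>T lT[OF t] by (simp add: \<gamma>_def)
        then have "\<exists>c. c \<in> A \<and> \<gamma> t \<in> fst c" using c by blast
        then have c': "c' \<in> A" "\<gamma> t \<in> fst c'"
          unfolding c'_def by (rule someI2_ex, blast)+
        have vd: "vector_derivative (snd c' \<circ> \<gamma>) (at t) = frechet_derivative (transition c c') (at (l t)) v"
          using der[OF c'(1) t c'(2)] by (rule vector_derivative_at)
        have pt: "snd c' (\<gamma> t) = transition c c' (l t)"
          using fun_cong[OF comp, of c' t] by simp
        have sp: "curve_speed A g \<gamma> t = sqrt (F (l t, v))"
          unfolding curve_speed_def Let_def c'_def[symmetric] vd pt F_def
          using metric_compatible[OF c(1) c'(1) overlap[OF t c'(2)], of v v] by simp
        have "dist (l t) z0 < r" using lb[OF t] by (simp add: dist_commute)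
        moreover have "norm v < 2 * r"
        proof -
          have "dist (\<phi> x) (\<phi> y) < 2 * r"
            using x y dist_triangle3[of "\<phi> x" "\<phi> y" z0] by (auto simp: U_def)
          then show ?thesis by (simp add: v_def dist_norm norm_minus_commute)
        qed
        ultimately have "dist (l t) z0 + norm v < d1" unfolding r_def by linarith
        moreover have "dist (l t, v) (z0, 0) \<le> dist (l t) z0 + norm v"
          using sqrt_sum_squares_le_sum[of "dist (l t) z0" "norm v"] by (simp add: dist_Pair_Pair)
        ultimately have "F (l t, v) < \<epsilon>\<^sup>2" using Fsmall[of "(l t, v)"] by simp
        then have "sqrt (F (l t, v)) \<le> sqrt (\<epsilon>\<^sup>2)" by (intro real_sqrt_le_mono) simp
        then show ?thesis using sp \<epsilon> by simp
      qed
      then show ?thesis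
        unfolding curve_length_def using \<epsilon>
        by (cases "curve_speed A g \<gamma> integrable_on {0..1}")
          (auto simp: not_integrable_integral dest: integral_le[of _ "{0..1}" "\<lambda>_. \<epsilon>"])
    qed
    ultimately show ?thesis by blast
  qed
  ultimately show ?thesis by blast
qed

lemma bdd_below_curve_lengths:
  "bdd_below {curve_length A g \<gamma> | \<gamma>. piecewise_C1_curve X A \<gamma> \<and> \<gamma> 0 = p \<and> \<gamma> 1 = q}"
  using curve_length_nonneg by (intro bdd_belowI[of _ 0]) auto

lemma riemannian_dist_locally_small:
  assumes "p \<in> topspace X" and "\<epsilon> > 0"
  shows "\<exists>U. openin X U \<and> p \<in> U \<and> (\<forall>x\<in>U. \<forall>y\<in>U. riemannian_dist X A g x y \<le> \<epsilon>)"
proof -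
  obtain U where U: "openin X U" "p \<in> U"
    "\<And>x y. x \<in> U \<Longrightarrow> y \<in> U \<Longrightarrow>
      \<exists>\<gamma>. piecewise_C1_curve X A \<gamma> \<and> \<gamma> 0 = x \<and> \<gamma> 1 = y \<and> curve_length A g \<gamma> \<le> \<epsilon>"
    using small_chart_segments[OF assms] by blast
  have "riemannian_dist X A g x y \<le> \<epsilon>" if xy: "x \<in> U" "y \<in> U" for x y
  proof -
    obtain \<gamma> where \<gamma>: "piecewise_C1_curve X A \<gamma>" "\<gamma> 0 = x" "\<gamma> 1 = y" "curve_length A g \<gamma> \<le> \<epsilon>"
      using U(3)[OF xy] by blast
    then have "riemannian_dist X A g x y \<le> curve_length A g \<gamma>"
      unfolding riemannian_dist_def by (intro cInf_lower bdd_below_curve_lengths) blast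
    then show ?thesis using \<gamma>(4) by simp
  qed
  then show ?thesis using U by blast
qed

text \<open>The points reachable from \<open>p\<close> form a clopen set. Appending a short segment
  reaches every point near a reachable one; and if a neighbourhood of \<open>x\<close> contains a
  reachable point, the segment from there to \<open>x\<close> makes \<open>x\<close>
  reachable.\<close>

lemma connected_imp_piecewise_C1_connected:
  assumes conn: "connected_space X" and p: "p \<in> topspace X" and q: "q \<in> topspace X"
  shows "\<exists>\<gamma>. piecewise_C1_curve X A \<gamma> \<and> \<gamma> 0 = p \<and> \<gamma> 1 = q"
proof -
  define R where "R = {q \<in> topspace X. \<exists>\<gamma>. piecewise_C1_curve X A \<gamma> \<and> \<gamma> 0 = p \<and> \<gamma> 1 = q}"
  have local: "\<exists>U. openin X U \<and> x \<in> U \<and>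
      (\<forall>y\<in>U. \<forall>z\<in>U. \<exists>\<gamma>. piecewise_C1_curve X A \<gamma> \<and> \<gamma> 0 = y \<and> \<gamma> 1 = z)" if "x \<in> topspace X" for x
    using small_chart_segments[OF that, of 1] by (metis zero_less_one)
  have step: "z \<in> R" if yz: "y \<in> R" "piecewise_C1_curve X A \<gamma>" "\<gamma> 0 = y" "\<gamma> 1 = z" for y z \<gamma>
  proof -
    obtain \<gamma>1 where \<gamma>1: "piecewise_C1_curve X A \<gamma>1" "\<gamma>1 0 = p" "\<gamma>1 1 = y"
      using yz(1) by (auto simp: R_def)
    have "z \<in> topspace X"
      using that path_finish_in_topspace unfolding piecewise_C1_curve_def by blast
    then show ?thesis
      using piecewise_C1_curve_join[OF \<gamma>1(1) that(2)] \<gamma>1 that(3,4) unfolding R_def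
      by (intro CollectI conjI exI[of _ "\<lambda>t. if t \<le> 1/2 then \<gamma>1 (2 * t) else \<gamma> (2 * t - 1)"]) auto
  qed
  have "openin X R"
  proof (subst openin_subopen, intro ballI)
    fix x assume x: "x \<in> R"
    then have "x \<in> topspace X" by (simp add: R_def)
    from local[OF this] show "\<exists>T. openin X T \<and> x \<in> T \<and> T \<subseteq> R"
      using step[OF x] by (metis subsetI)
  qed
  moreover have "openin X (topspace X - R)"
  proof (subst openin_subopen, intro ballI)
    fix x assume x: "x \<in> topspace X - R"
    then obtain U where U: "openin X U" "x \<in> U"
      "\<forall>y\<in>U. \<forall>z\<in>U. \<exists>\<gamma>. piecewise_C1_curve X A \<gamma> \<and> \<gamma> 0 = y \<and> \<gamma> 1 = z"
      using local by blast
    then have "U \<subseteq> topspace X - R"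
      using step x openin_subset[OF U(1)] by blast
    then show "\<exists>T. openin X T \<and> x \<in> T \<and> T \<subseteq> topspace X - R" using U by blast
  qed
  moreover have "R \<subseteq> topspace X" by (auto simp: R_def)
  moreover have "p \<in> R"
    using local[OF p] p by (auto simp: R_def)
  ultimately have "R = topspace X"
    using conn unfolding connected_space_clopen_in closedin_def by blast
  then show ?thesis using q by (auto simp: R_def)
qed

text \<open>The infimum of the empty set of reals has no prescribed value, so the lower bound 0 for
  the lengths must be supplemented by the existence of a joining curve, where connectedness
  enters.\<close>

lemma riemannian_dist_nonneg:
  assumes "connected_space X" and "p \<in> topspace X" and "q \<in> topspace X"
  shows "riemannian_dist X A g p q \<ge> 0"
  unfolding riemannian_dist_def
proof (rule cInf_greatest)
  show "{curve_length A g \<gamma> | \<gamma>. piecewise_C1_curve X A \<gamma> \<and> \<gamma> 0 = p \<and> \<gamma> 1 = q} \<noteq> {}"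
    using connected_imp_piecewise_C1_connected[OF assms] by blast
next
  fix x assume "x \<in> {curve_length A g \<gamma> | \<gamma>. piecewise_C1_curve X A \<gamma> \<and> \<gamma> 0 = p \<and> \<gamma> 1 = q}"
  then show "0 \<le> x" by (elim CollectE exE conjE) (simp add: curve_length_nonneg)
qed

end


section \<open>Empirical measures and Lipschitz functions\<close>

lemma space_borel_measure_space [simp]: "space (borel_measure_space X) = topspace X"
  unfolding borel_measure_space_def by (rule space_measure_of) (auto dest: openin_subset)

lemma sets_borel_measure_space_openin: "openin X U \<Longrightarrow> U \<in> sets (borel_measure_space X)"
  unfolding borel_measure_space_def
  by (subst sets_measure_of) (auto dest: openin_subset intro: sigma_sets.Basic)

text \<open>\<open>measure_of\<close> has the prescribed values only if these form a measure.
  Recognizing them as the values of a push-forward of the uniform measure on the indices settles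
  this.\<close>

lemma empirical_measure_eq_distr:
  assumes p: "\<And>i. i \<in> {1..N} \<Longrightarrow> p i \<in> space M"
  shows "empirical_measure M p N = distr (uniform_count_measure {1..N}) M p" (is "_ = ?D")
proof -
  have meas: "p \<in> measurable (uniform_count_measure {1..N}) M"
    using p by (auto simp: measurable_def space_uniform_count_measure sets_uniform_count_measure)
  have "empirical_measure M p N = measure_of (space M) (sets M) (emeasure ?D)"
    unfolding empirical_measure_def
  proof (rule measure_of_eq[OF sets.space_closed])
    fix B assume "B \<in> sigma_sets (space M) (sets M)"
    then have B: "B \<in> sets M" by (simp add: sets.sigma_sets_eq)
    have "(\<Sum>i=1..N. emeasure (return M (p i)) B) = (\<Sum>i\<in>{1..N}. if p i \<in> B then 1 else 0)"
      using B by (intro sum.cong refl) (simp add: indicator_def)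
    also have "\<dots> = of_nat (card {i\<in>{1..N}. p i \<in> B})"
      by (subst sum.inter_filter[symmetric]) simp_all
    finally have "(\<Sum>i=1..N. emeasure (return M (p i)) B) / of_nat N =
        of_nat (card {i\<in>{1..N}. p i \<in> B}) / of_nat N" by simp
    also have "\<dots> = emeasure ?D B"
    proof (cases "N = 0")
      case False
      have "emeasure ?D B = emeasure (uniform_count_measure {1..N}) {i\<in>{1..N}. p i \<in> B}"
        using meas B by (subst emeasure_distr)
          (auto simp: space_uniform_count_measure intro!: arg_cong2[where f=emeasure])
      also have "\<dots> = ennreal (card {i\<in>{1..N}. p i \<in> B} / N)"
        by (subst emeasure_uniform_count_measure) auto
      also have "\<dots> = of_nat (card {i\<in>{1..N}. p i \<in> B}) / of_nat N"
        using False by (simp add: divide_ennreal[symmetric] ennreal_of_nat_eq_real_of_nat)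
      finally show ?thesis by simp
    next
      \<comment> \<open>For \<open>N = 0\<close> the quotient 0 / 0 is 0 in \<open>ennreal\<close>,
        and so is the uniform measure of the empty index set.\<close>
      case True
      then show ?thesis using meas B
        by (simp add: emeasure_distr emeasure_uniform_count_measure_if space_uniform_count_measure)
    qed
    finally show "(\<Sum>i=1..N. emeasure (return M (p i)) B) / of_nat N = emeasure ?D B" .
  qed
  also have "\<dots> = ?D"
    using measure_of_of_measure[of ?D] by simp
  finally show ?thesis .
qed

lemma
  assumes p: "\<And>i. i \<in> {1..N} \<Longrightarrow> p i \<in> space M"
  shows sets_empirical_measure: "sets (empirical_measure M p N) = sets M"
    and prob_space_empirical_measure: "N \<ge> 1 \<Longrightarrow> prob_space (empirical_measure M p N)"
    and measure_empirical_measure: "B \<in> sets M \<Longrightarrow>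
      measure (empirical_measure M p N) B = (\<Sum>i=1..N. indicator B (p i)) / N"
proof -
  have meas: "p \<in> measurable (uniform_count_measure {1..N}) M"
    using p by (auto simp: measurable_def space_uniform_count_measure sets_uniform_count_measure)
  have eq: "empirical_measure M p N = distr (uniform_count_measure {1..N}) M p"
    using p by (rule empirical_measure_eq_distr)
  show "sets (empirical_measure M p N) = sets M" by (simp add: eq)
  show "prob_space (empirical_measure M p N)" if "N \<ge> 1"
    unfolding eq
    by (rule prob_space.prob_space_distr[OF prob_space_uniform_count_measure meas]) (use that in simp_all)
  assume B: "B \<in> sets M"
  have "measure (empirical_measure M p N) B = measure (uniform_count_measure {1..N}) {i\<in>{1..N}. p i \<in> B}"
    unfolding eq using meas B by (subst measure_distr)
      (auto simp: space_uniform_count_measure intro!: arg_cong2[where f=measure])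
  also have "\<dots> = card {i\<in>{1..N}. p i \<in> B} / N"
    by (subst measure_uniform_count_measure) auto
  also have "real (card {i\<in>{1..N}. p i \<in> B}) = (\<Sum>i=1..N. indicator B (p i))"
    unfolding indicator_def by (simp add: sum.If_cases of_bool_def Int_def)
  finally show "measure (empirical_measure M p N) B = (\<Sum>i=1..N. indicator B (p i)) / N" .
qed

text \<open>The indicators take values in [0,1], so the mean of n of them deviates by at least
  \<epsilon> with probability at most \<open>2 * exp (-2 * \<epsilon>\<^sup>2) ^ n\<close>, the term
  of a convergent geometric series.\<close>

lemma (in prob_space) strong_law_indicator:
  assumes ind: "indep_vars (\<lambda>_. S) P {1..}"
    and dist: "\<And>i. i \<ge> (1::nat) \<Longrightarrow> distr M S (P i) = \<nu>"
    and B: "B \<in> sets S"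
  shows "AE \<omega> in M. (\<lambda>N. (\<Sum>i=1..N. indicator B (P i \<omega>)) / real N) \<longlonglongrightarrow> measure \<nu> B"
proof -
  define Y where "Y = (\<lambda>i \<omega>. indicator B (P i \<omega>) :: real)"
  have P [measurable]: "P i \<in> measurable M S" if "i \<ge> 1" for i
    using ind that unfolding indep_vars_def by auto
  have indY: "indep_vars (\<lambda>_. borel) Y {1..}"
    unfolding Y_def using B by (intro indep_vars_compose2[OF ind]) auto
  have Ym: "Y i \<in> borel_measurable M" if "i \<ge> 1" for i
    using indY that unfolding indep_vars_def by auto
  have EY: "expectation (Y i) = measure \<nu> B" if "i \<ge> 1" for i
  proof -
    have "measure \<nu> B = measure (distr M S (P i)) B" using dist[OF that] by simp
    also have "\<dots> = (LINT x|distr M S (P i). indicator B x)"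
      using B by simp
    also have "\<dots> = expectation (Y i)"
      unfolding Y_def using P[OF that] B by (subst integral_distr) auto
    finally show ?thesis by simp
  qed
  have ev: "AE \<omega> in M. eventually (\<lambda>N. \<bar>(\<Sum>i=1..N. Y i \<omega>) / N - measure \<nu> B\<bar> < \<epsilon>) sequentially" if \<epsilon>: "\<epsilon> > 0" for \<epsilon> :: real
  proof -
    \<comment> \<open>\<open>E N\<close> concerns \<open>Suc N\<close> summands, so the division by
      their number is harmless; the shift is undone at the end by
      \<open>eventually_sequentially_Suc\<close>.\<close>
    define E where "E = (\<lambda>N. {\<omega>\<in>space M. \<bar>(\<Sum>i=1..Suc N. Y i \<omega>) - (\<Sum>i=1..Suc N. expectation (Y i))\<bar> \<ge> Suc N * \<epsilon>})"
    have bound: "prob (E N) \<le> 2 * exp (-2 * \<epsilon>\<^sup>2) ^ Suc N" for N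
    proof -
      interpret Hoeffding_ineq M "{1..Suc N}" Y "\<lambda>_. 0" "\<lambda>_. 1" "\<Sum>i=1..Suc N. expectation (Y i)"
      proof unfold_locales
        show "indep_vars (\<lambda>_. borel) Y {1..Suc N}"
          by (rule indep_vars_subset[OF indY]) auto
        show "AE \<omega> in M. Y i \<omega> \<in> {0..1}" for i
          by (simp add: Y_def)
      qed simp_all
      have "prob (E N) \<le> 2 * exp (-2 * (Suc N * \<epsilon>)\<^sup>2 / (\<Sum>i\<in>{1..Suc N}. (1 - 0)\<^sup>2))"
        unfolding E_def by (rule Hoeffding_ineq_abs_ge) (use \<epsilon> in auto)
      also have "-2 * (Suc N * \<epsilon>)\<^sup>2 / (\<Sum>i\<in>{1..Suc N}. (1 - 0)\<^sup>2) = Suc N * (-2 * \<epsilon>\<^sup>2)"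
        by (simp add: power2_eq_square field_simps del: of_nat_Suc)
      finally show ?thesis unfolding exp_of_nat_mult .
    qed
    have [measurable]: "Y i \<in> borel_measurable M" if "i \<in> {1..Suc N}" for i N
      using Ym that by simp
    have Em: "E N \<in> sets M" for N
      unfolding E_def by measurable
    have "summable (\<lambda>N. 2 * exp (-2 * \<epsilon>\<^sup>2) ^ Suc N)"
      using \<epsilon> by (simp add: summable_geometric summable_mult)
    then have "summable (\<lambda>N. prob (E N))"
      by (rule summable_comparison_test'[where N=0]) (use bound in auto)
    then have "AE \<omega> in M. eventually (\<lambda>N. \<omega> \<in> space M - E N) sequentially"
      by (intro borel_cantelli_AE1 Em) (auto simp: emeasure_eq_measure)
    then show ?thesis
    proof eventually_elim
      case (elim \<omega>)
      then have "eventually (\<lambda>N. \<bar>(\<Sum>i=1..Suc N. Y i \<omega>) / Suc N - measure \<nu> B\<bar> < \<epsilon>) sequentially"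
      proof eventually_elim
        case (elim N)
        have "\<bar>(\<Sum>i=1..Suc N. Y i \<omega>) - Suc N * measure \<nu> B\<bar> < Suc N * \<epsilon>"
          using elim by (auto simp: E_def EY)
        moreover have "(\<Sum>i=1..Suc N. Y i \<omega>) / Suc N - measure \<nu> B = ((\<Sum>i=1..Suc N. Y i \<omega>) - Suc N * measure \<nu> B) / Suc N"
          by (simp add: field_simps del: of_nat_Suc)
        ultimately show ?case by (simp add: field_simps del: of_nat_Suc)
      qed
      then show ?case by (subst (asm) eventually_sequentially_Suc)
    qed
  qed
  \<comment> \<open>The tolerances \<open>1 / Suc k\<close> are countably many, so one null set
    serves all of them.\<close>
  have "AE \<omega> in M. \<forall>k. eventually (\<lambda>N. \<bar>(\<Sum>i=1..N. Y i \<omega>) / N - measure \<nu> B\<bar> < 1 / Suc k) sequentially"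
    unfolding AE_all_countable by (intro allI ev) simp
  then show ?thesis
  proof eventually_elim
    case (elim \<omega>)
    show ?case
    proof (rule tendstoI)
      fix e :: real assume "e > 0"
      then obtain k where "1 / Suc k < e" using nat_approx_posE by blast
      with elim[rule_format, of k]
      show "eventually (\<lambda>N. dist ((\<Sum>i=1..N. indicator B (P i \<omega>)) / real N) (measure \<nu> B) < e) sequentially"
        by (auto simp: dist_real_def Y_def elim: eventually_mono)
    qed
  qed
qed

section \<open>Estimates that are uniform over all 1-Lipschitz functions\<close>

definition one_Lipschitz_on :: "'a set \<Rightarrow> ('a \<Rightarrow> 'a \<Rightarrow> real) \<Rightarrow> ('a \<Rightarrow> real) set" where
  "one_Lipschitz_on M d = {f. \<forall>x\<in>M. \<forall>y\<in>M. \<bar>f x - f y\<bar> \<le> d x y}"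

text \<open>The interface between geometry and measure theory: the partition, the common bound and
  the convergence below are all derived from these two properties of \<open>d\<close>.\<close>

locale locally_small_dist =
  fixes X :: "'a topology" and d :: "'a \<Rightarrow> 'a \<Rightarrow> real"
  assumes dist_nonneg: "x \<in> topspace X \<Longrightarrow> y \<in> topspace X \<Longrightarrow> d x y \<ge> 0"
    and locally_small: "p \<in> topspace X \<Longrightarrow> \<epsilon> > 0 \<Longrightarrow>
      \<exists>U. openin X U \<and> p \<in> U \<and> (\<forall>x\<in>U. \<forall>y\<in>U. d x y \<le> \<epsilon>)"
begin

text \<open>Preimages of open sets are open: on a neighbourhood where \<open>d\<close> is at most
  \<open>e / 2\<close>, the function varies by less than \<open>e\<close>.\<close>

lemma Lipschitz_measurable:
  assumes f: "f \<in> one_Lipschitz_on (topspace X) d"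
  shows "f \<in> borel_measurable (borel_measure_space X)"
proof (rule borel_measurableI)
  fix T :: "real set" assume T: "open T"
  have "openin X (f -` T \<inter> topspace X)"
  proof (subst openin_subopen, intro ballI)
    fix x assume x: "x \<in> f -` T \<inter> topspace X"
    then obtain e where e: "e > 0" "\<And>y. dist y (f x) < e \<Longrightarrow> y \<in> T"
      using T unfolding open_dist by blast
    obtain U where U: "openin X U" "x \<in> U" "\<And>a b. a \<in> U \<Longrightarrow> b \<in> U \<Longrightarrow> d a b \<le> e / 2"
      using locally_small[of x "e / 2"] x e by auto
    have "U \<subseteq> f -` T \<inter> topspace X"
    proof
      fix y assume y: "y \<in> U"
      then have yX: "y \<in> topspace X" using U openin_subset by blast
      then have "\<bar>f y - f x\<bar> \<le> d y x" using f x by (auto simp: one_Lipschitz_on_def)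
      also have "\<dots> \<le> e / 2" using U y by blast
      finally have "f y \<in> T" using e by (intro e(2)) (simp add: dist_real_def)
      then show "y \<in> f -` T \<inter> topspace X" using yX by simp
    qed
    then show "\<exists>T'. openin X T' \<and> x \<in> T' \<and> T' \<subseteq> f -` T \<inter> topspace X" using U by blast
  qed
  then show "f -` T \<inter> space (borel_measure_space X) \<in> sets (borel_measure_space X)"
    by (simp add: sets_borel_measure_space_openin)
qed

lemma finite_small_partition:
  assumes comp: "compact_space X" and \<epsilon>: "\<epsilon> > 0"
  shows "\<exists>m (B :: nat \<Rightarrow> 'a set). (\<Union>i<m. B i) = topspace X \<and> disjoint_family B \<and>
    (\<forall>i. B i \<in> sets (borel_measure_space X)) \<and> (\<forall>i<m. \<forall>x\<in>B i. \<forall>y\<in>B i. d x y \<le> \<epsilon>)"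
proof -
  define \<U> where "\<U> = {U. openin X U \<and> (\<forall>x\<in>U. \<forall>y\<in>U. d x y \<le> \<epsilon>)}"
  have "\<Union>\<U> = topspace X"
  proof
    show "\<Union>\<U> \<subseteq> topspace X" by (auto simp: \<U>_def dest: openin_subset)
    show "topspace X \<subseteq> \<Union>\<U>" using locally_small[OF _ \<epsilon>] by (fastforce simp: \<U>_def)
  qed
  moreover have "\<forall>U\<in>\<U>. openin X U" by (simp add: \<U>_def)
  ultimately obtain \<F> where \<F>: "finite \<F>" "\<F> \<subseteq> \<U>" "\<Union>\<F> = topspace X"
    using comp unfolding compact_space by meson
  obtain m and U :: "nat \<Rightarrow> 'a set" where U: "\<F> = U ` {i. i < m}"
    using finite_imp_nat_seg_image_inj_on[OF \<F>(1)] by blast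
  \<comment> \<open>Padding with empty sets gives a sequence over all of \<open>nat\<close>. Passing
    to \<open>disjointed\<close> only shrinks the sets, so the bound on \<open>d\<close>
    survives.\<close>
  define V where "V = (\<lambda>i. if i < m then U i else {})"
  have V: "V i \<in> sets (borel_measure_space X)" for i
    using U \<F>(2) by (auto simp: V_def \<U>_def intro!: sets_borel_measure_space_openin)
  have "(\<Union>i<m. disjointed V i) = (\<Union>i<m. V i)"
    using UN_disjointed_eq[of V] finite_UN_disjointed_eq[of V m] by (simp add: lessThan_atLeast0)
  also have "\<dots> = topspace X" using U \<F>(3) by (auto simp: V_def)
  finally have un: "(\<Union>i<m. disjointed V i) = topspace X" .
  moreover have "disjointed V i \<in> sets (borel_measure_space X)" for i
    using V sets.range_disjointed_sets[of V "borel_measure_space X"] by blast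
  moreover have "\<forall>i<m. \<forall>x\<in>disjointed V i. \<forall>y\<in>disjointed V i. d x y \<le> \<epsilon>"
  proof (intro allI impI ballI)
    fix i x y assume i: "i < m" and xy: "x \<in> disjointed V i" "y \<in> disjointed V i"
    have "x \<in> U i" "y \<in> U i" using xy disjointed_subset[of V i] i by (auto simp: V_def)
    moreover have "U i \<in> \<U>" using U \<F>(2) i by auto
    ultimately show "d x y \<le> \<epsilon>" by (auto simp: \<U>_def)
  qed
  ultimately show ?thesis
    using disjoint_family_disjointed[of V] by (intro exI[of _ m] exI[of _ "disjointed V"]) blast
qed

text \<open>A bound at \<open>x\<close> that is uniform in \<open>f\<close> passes to any
  \<open>y\<close> with \<open>d y x \<le> 1\<close> at the cost of adding 1. The points with such a
  bound therefore form a clopen set containing \<open>x0\<close>, which is everything. Finitely many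
  pieces on which each \<open>f\<close> varies by at most 1 then make the bound uniform in the point
  too.\<close>

lemma Lipschitz_uniformly_bounded:
  assumes comp: "compact_space X" and conn: "connected_space X" and x0: "x0 \<in> topspace X"
  shows "\<exists>K. \<forall>f\<in>one_Lipschitz_on (topspace X) d. \<forall>x\<in>topspace X. \<bar>f x - f x0\<bar> \<le> K"
proof -
  define L where "L = one_Lipschitz_on (topspace X) d"
  define R where "R = {x\<in>topspace X. \<exists>K. \<forall>f\<in>L. \<bar>f x - f x0\<bar> \<le> K}"
  have close: "\<bar>f x - f y\<bar> \<le> d x y" if "f \<in> L" "x \<in> topspace X" "y \<in> topspace X" for f x y
    using that by (auto simp: L_def one_Lipschitz_on_def)
  have step: "y \<in> R" if xy: "x \<in> R" "y \<in> topspace X" "d y x \<le> 1" for x y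
  proof -
    obtain K where K: "\<forall>f\<in>L. \<bar>f x - f x0\<bar> \<le> K" and x: "x \<in> topspace X"
      using xy(1) by (auto simp: R_def)
    have "\<bar>f y - f x0\<bar> \<le> K + 1" if "f \<in> L" for f
      using close[OF that \<open>y \<in> topspace X\<close> x] K that \<open>d y x \<le> 1\<close> by fastforce
    then show ?thesis using that(2) by (auto simp: R_def)
  qed
  have local: "\<exists>U. openin X U \<and> p \<in> U \<and> (\<forall>x\<in>U. \<forall>y\<in>U. d x y \<le> 1)" if "p \<in> topspace X" for p
    using locally_small[OF that, of 1] by simp
  have "openin X R"
  proof (subst openin_subopen, intro ballI)
    fix x assume x: "x \<in> R"
    then obtain U where U: "openin X U" "x \<in> U" "\<forall>x\<in>U. \<forall>y\<in>U. d x y \<le> 1"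
      using local[of x] by (auto simp: R_def)
    then have "U \<subseteq> R" using step[OF x] openin_subset[OF U(1)] by blast
    then show "\<exists>T. openin X T \<and> x \<in> T \<and> T \<subseteq> R" using U by blast
  qed
  moreover have "openin X (topspace X - R)"
  proof (subst openin_subopen, intro ballI)
    fix x assume x: "x \<in> topspace X - R"
    then obtain U where U: "openin X U" "x \<in> U" "\<forall>x\<in>U. \<forall>y\<in>U. d x y \<le> 1"
      using local[of x] by auto
    then have "U \<subseteq> topspace X - R" using step x openin_subset[OF U(1)] by blast
    then show "\<exists>T. openin X T \<and> x \<in> T \<and> T \<subseteq> topspace X - R" using U by blast
  qed
  moreover have "R \<subseteq> topspace X" by (auto simp: R_def)
  moreover have "x0 \<in> R" using x0 by (auto simp: R_def)
  ultimately have R: "R = topspace X"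
    using conn unfolding connected_space_clopen_in closedin_def by blast
  obtain m and B :: "nat \<Rightarrow> 'a set" where B: "(\<Union>i<m. B i) = topspace X" "\<And>i x y. i < m \<Longrightarrow> x \<in> B i \<Longrightarrow> y \<in> B i \<Longrightarrow> d x y \<le> 1"
    using finite_small_partition[OF comp zero_less_one] by blast
  have "\<exists>K. \<forall>f\<in>L. \<forall>x\<in>B i. \<bar>f x - f x0\<bar> \<le> K" if i: "i < m" for i
  proof (cases "B i = {}")
    case False
    then obtain y where y: "y \<in> B i" by blast
    then have "y \<in> R" using B(1) R i by blast
    then obtain K where K: "\<forall>f\<in>L. \<bar>f y - f x0\<bar> \<le> K" by (auto simp: R_def)
    have "\<bar>f x - f x0\<bar> \<le> K + 1" if "f \<in> L" "x \<in> B i" for f x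
    proof -
      have "\<bar>f x - f y\<bar> \<le> 1"
        using close[OF that(1), of x y] B i that y by fastforce
      then show ?thesis using K that by fastforce
    qed
    then show ?thesis by blast
  qed auto
  then obtain K where K: "\<And>i f x. i < m \<Longrightarrow> f \<in> L \<Longrightarrow> x \<in> B i \<Longrightarrow> \<bar>f x - f x0\<bar> \<le> K i"
    by metis
  \<comment> \<open>The sum dominates each single bound; absolute values are taken because nothing
    fixes the sign of \<open>K i\<close> on an empty piece.\<close>
  have "\<bar>f x - f x0\<bar> \<le> (\<Sum>i<m. \<bar>K i\<bar>)" if f: "f \<in> L" and x: "x \<in> topspace X" for f x
  proof -
    obtain i where i: "i < m" "x \<in> B i" using B(1) x by blast
    have "\<bar>f x - f x0\<bar> \<le> \<bar>K i\<bar>" using K[OF i(1) f i(2)] by simp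
    also have "\<dots> \<le> (\<Sum>i<m. \<bar>K i\<bar>)" using i by (intro member_le_sum) auto
    finally show ?thesis .
  qed
  then show ?thesis unfolding L_def by blast
qed

text \<open>Each integral is compared with that of the step function with value
  \<open>f (z i)\<close> on \<open>B i\<close>, at cost \<epsilon> each. Both measures have mass 1,
  so subtracting \<open>f x0\<close> leaves the difference unchanged while bounding the coefficients
  by \<open>K\<close>. The resulting estimate depends on \<open>f\<close> only through
  \<open>K\<close>.\<close>

lemma integral_diff_le_partition:
  fixes \<mu> \<nu> :: "'a measure" and m :: nat and B :: "nat \<Rightarrow> 'a set"
  assumes \<mu>: "prob_space \<mu>" "sets \<mu> = sets (borel_measure_space X)"
    and \<nu>: "prob_space \<nu>" "sets \<nu> = sets (borel_measure_space X)"
    and f: "f \<in> one_Lipschitz_on (topspace X) d"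
    and x0: "x0 \<in> topspace X" and K: "\<And>x. x \<in> topspace X \<Longrightarrow> \<bar>f x - f x0\<bar> \<le> K"
    and B: "(\<Union>i<m. B i) = topspace X" "disjoint_family B" "\<And>i. B i \<in> sets (borel_measure_space X)"
      "\<And>i x y. i < m \<Longrightarrow> x \<in> B i \<Longrightarrow> y \<in> B i \<Longrightarrow> d x y \<le> \<epsilon>"
  shows "(LINT x|\<mu>. f x) - (LINT x|\<nu>. f x) \<le> 2 * \<epsilon> + K * (\<Sum>i<m. \<bar>measure \<mu> (B i) - measure \<nu> (B i)\<bar>)"
proof -
  \<comment> \<open>The default \<open>x0\<close> on an empty piece keeps the sample point in the
    space, so that \<open>a i\<close> is bounded by \<open>K\<close> for every
    \<open>i < m\<close>.\<close>
  define z where "z = (\<lambda>i. if B i = {} then x0 else SOME x. x \<in> B i)"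
  have z: "z i \<in> B i" if "B i \<noteq> {}" for i
    using that by (auto simp: z_def intro: someI_ex)
  have zX: "z i \<in> topspace X" if "i < m" for i
    using z[of i] B(1) that x0 by (cases "B i = {}") (auto simp: z_def)
  define a where "a = (\<lambda>i. f (z i) - f x0)"
  define h where "h = (\<lambda>x. \<Sum>i<m. a i * indicator (B i) x)"
  have a: "\<bar>a i\<bar> \<le> K" if "i < m" for i using K[OF zX[OF that]] by (simp add: a_def)
  have approx: "\<bar>(f x - f x0) - h x\<bar> \<le> \<epsilon>" if x: "x \<in> topspace X" for x
  proof -
    obtain i where i: "i < m" "x \<in> B i" using B(1) x by blast
    have "h x = (\<Sum>j<m. if j = i then a i else 0)"
      unfolding h_def
    proof (intro sum.cong refl)
      fix j show "a j * indicator (B j) x = (if j = i then a i else 0)"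
        using B(2) i(2) by (auto simp: indicator_def disjoint_family_on_def)
    qed
    also have "\<dots> = a i" using i(1) by (subst sum.delta) auto
    finally have "h x = a i" .
    then have "\<bar>(f x - f x0) - h x\<bar> = \<bar>f x - f (z i)\<bar>" by (simp add: a_def)
    also have "\<dots> \<le> d x (z i)" using f x zX[OF i(1)] by (auto simp: one_Lipschitz_on_def)
    also have "\<dots> \<le> \<epsilon>" using B(4)[OF i] z[of i] i by blast
    finally show ?thesis .
  qed
  have main: "\<bar>(LINT x|\<rho>. f x) - f x0 - (\<Sum>i<m. a i * measure \<rho> (B i))\<bar> \<le> \<epsilon>"
    if \<rho>: "prob_space \<rho>" and sets: "sets \<rho> = sets (borel_measure_space X)" for \<rho> :: "'a measure"
  proof -
    interpret \<rho>: prob_space \<rho> by fact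
    have sp: "space \<rho> = topspace X" using sets_eq_imp_space_eq[OF sets] by simp
    have fm: "f \<in> borel_measurable \<rho>"
      using Lipschitz_measurable[OF f] measurable_cong_sets[OF sets refl] by blast
    have bnd: "\<bar>f x\<bar> \<le> K + \<bar>f x0\<bar>" if "x \<in> topspace X" for x
      using K[OF that] by linarith
    have fi: "integrable \<rho> f"
      by (rule \<rho>.integrable_const_bound[of _ "K + \<bar>f x0\<bar>"]) (use bnd fm sp in \<open>auto intro!: AE_I2\<close>)
    have Bs: "B i \<in> sets \<rho>" for i using B(3) sets by simp
    have hi: "integrable \<rho> h"
      unfolding h_def using Bs by (intro Bochner_Integration.integrable_sum integrable_mult_right) (auto simp: \<rho>.emeasure_eq_measure)
    have "(LINT x|\<rho>. h x) = (\<Sum>i<m. a i * measure \<rho> (B i))"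
      unfolding h_def using Bs
      by (subst Bochner_Integration.integral_sum)
        (auto intro!: integrable_mult_right sum.cong simp: \<rho>.emeasure_eq_measure)
    then have "(LINT x|\<rho>. (f x - f x0) - h x) = (LINT x|\<rho>. f x) - f x0 - (\<Sum>i<m. a i * measure \<rho> (B i))"
      using fi hi by (simp add: \<rho>.prob_space)
    moreover have "\<bar>LINT x|\<rho>. (f x - f x0) - h x\<bar> \<le> \<epsilon>"
    proof -
      have "\<bar>LINT x|\<rho>. (f x - f x0) - h x\<bar> \<le> (LINT x|\<rho>. \<bar>(f x - f x0) - h x\<bar>)"
        using integral_norm_bound[of \<rho> "\<lambda>x. (f x - f x0) - h x"] by simp
      also have "\<dots> \<le> \<epsilon>"
        by (rule \<rho>.integral_le_const) (use fi hi approx sp in \<open>auto intro!: AE_I2\<close>)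
      finally show ?thesis .
    qed
    ultimately show ?thesis by simp
  qed
  have "(\<Sum>i<m. a i * measure \<mu> (B i)) - (\<Sum>i<m. a i * measure \<nu> (B i)) =
      (\<Sum>i<m. a i * (measure \<mu> (B i) - measure \<nu> (B i)))"
    by (simp add: sum_subtractf right_diff_distrib)
  also have "\<dots> \<le> (\<Sum>i<m. K * \<bar>measure \<mu> (B i) - measure \<nu> (B i)\<bar>)"
  proof (rule sum_mono)
    fix i assume "i \<in> {..<m}"
    then have "\<bar>a i\<bar> * \<bar>measure \<mu> (B i) - measure \<nu> (B i)\<bar> \<le> K * \<bar>measure \<mu> (B i) - measure \<nu> (B i)\<bar>"
      using a by (intro mult_right_mono) auto
    then show "a i * (measure \<mu> (B i) - measure \<nu> (B i)) \<le> K * \<bar>measure \<mu> (B i) - measure \<nu> (B i)\<bar>"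
      by (metis abs_ge_self abs_mult order_trans)
  qed
  finally show ?thesis
    using main[OF \<mu>] main[OF \<nu>] by (simp add: sum_distrib_left)
qed

text \<open>The zero function is admissible because \<open>d\<close> is nonnegative on the space,
  and it contributes 0 to the supremum.\<close>

lemma kantorovich_dist_nonneg: "kantorovich_dist (topspace X) d \<mu> \<nu> \<ge> 0"
  unfolding kantorovich_dist_def
  by (rule SUP_upper2[of "\<lambda>_. 0"]) (auto simp: dist_nonneg zero_ereal_def)

text \<open>\<open>conv\<close> involves only countably many sets, so it can hold almost surely for
  random measures. The condition on \<open>\<mu>\<close> is eventual because the empirical measure
  of no points has mass 0.\<close>

lemma kantorovich_dist_tendsto_0:
  assumes comp: "compact_space X" and conn: "connected_space X"
    and \<mu>: "eventually (\<lambda>N. prob_space (\<mu> N) \<and> sets (\<mu> N) = sets (borel_measure_space X)) sequentially"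
    and \<nu>: "prob_space \<nu>" "sets \<nu> = sets (borel_measure_space X)"
    and conv: "\<And>k::nat. \<exists>m (B :: nat \<Rightarrow> 'a set). (\<Union>i<m. B i) = topspace X \<and> disjoint_family B \<and>
      (\<forall>i. B i \<in> sets (borel_measure_space X)) \<and> (\<forall>i<m. \<forall>x\<in>B i. \<forall>y\<in>B i. d x y \<le> 1 / Suc k) \<and>
      (\<forall>i. (\<lambda>N. measure (\<mu> N) (B i)) \<longlonglongrightarrow> measure \<nu> (B i))"
  shows "(\<lambda>N. kantorovich_dist (topspace X) d (\<mu> N) \<nu>) \<longlonglongrightarrow> 0"
proof -
  interpret \<nu>: prob_space \<nu> by fact
  have "topspace X \<noteq> {}"
    using \<nu>.not_empty sets_eq_imp_space_eq[OF \<nu>(2)] by simp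
  then obtain x0 where x0: "x0 \<in> topspace X" by blast
  obtain K where K: "\<And>f x. f \<in> one_Lipschitz_on (topspace X) d \<Longrightarrow> x \<in> topspace X \<Longrightarrow> \<bar>f x - f x0\<bar> \<le> K"
    using Lipschitz_uniformly_bounded[OF comp conn x0] by blast
  have ev: "eventually (\<lambda>N. kantorovich_dist (topspace X) d (\<mu> N) \<nu> \<le> ereal e) sequentially" if e: "e > 0" for e
  proof -
    \<comment> \<open>The fineness counts twice in the estimate, so \<open>e / 4\<close> uses up
      \<open>e / 2\<close> and leaves the other half to the sum over the pieces.\<close>
    obtain k where k: "1 / Suc k < e / 4" using nat_approx_posE[of "e / 4"] e by auto
    obtain m and B :: "nat \<Rightarrow> 'a set" where B: "(\<Union>i<m. B i) = topspace X" "disjoint_family B" "\<And>i. B i \<in> sets (borel_measure_space X)"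
      "\<And>i x y. i < m \<Longrightarrow> x \<in> B i \<Longrightarrow> y \<in> B i \<Longrightarrow> d x y \<le> 1 / Suc k"
      and lim: "\<And>i. (\<lambda>N. measure (\<mu> N) (B i)) \<longlonglongrightarrow> measure \<nu> (B i)"
      using conv[of k] by blast
    have "(\<lambda>N. K * (\<Sum>i<m. \<bar>measure (\<mu> N) (B i) - measure \<nu> (B i)\<bar>)) \<longlonglongrightarrow> K * (\<Sum>i<m. \<bar>measure \<nu> (B i) - measure \<nu> (B i)\<bar>)"
      by (intro tendsto_intros lim)
    then have "eventually (\<lambda>N. K * (\<Sum>i<m. \<bar>measure (\<mu> N) (B i) - measure \<nu> (B i)\<bar>) < e / 2) sequentially"
      using e by (intro order_tendstoD(2)[of _ 0]) auto
    with \<mu> show ?thesis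
    proof eventually_elim
      case (elim N)
      have "(LINT x|\<mu> N. f x) - (LINT x|\<nu>. f x) \<le> e" if f: "f \<in> one_Lipschitz_on (topspace X) d" for f
      proof -
        have "(LINT x|\<mu> N. f x) - (LINT x|\<nu>. f x)
            \<le> 2 * (1 / Suc k) + K * (\<Sum>i<m. \<bar>measure (\<mu> N) (B i) - measure \<nu> (B i)\<bar>)"
          by (rule integral_diff_le_partition[OF _ _ \<nu> f x0 K[OF f] B]) (use elim in auto)
        then show ?thesis using elim k by linarith
      qed
      then show ?case
        unfolding kantorovich_dist_def one_Lipschitz_on_def by (intro SUP_least) auto
    qed
  qed
  show ?thesis
  proof (rule order_tendstoI)
    fix a :: ereal assume "a < 0"
    then show "eventually (\<lambda>N. a < kantorovich_dist (topspace X) d (\<mu> N) \<nu>) sequentially"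
      using kantorovich_dist_nonneg less_le_trans by (intro always_eventually allI) blast
  next
    fix a :: ereal assume "0 < a"
    \<comment> \<open>A real number strictly between 0 and \<open>a\<close> turns a non-strict bound
      into a strict one and covers infinite \<open>a\<close>.\<close>
    then obtain e where e: "0 < ereal e" "ereal e < a"
      using ereal_dense2 by blast
    then show "eventually (\<lambda>N. kantorovich_dist (topspace X) d (\<mu> N) \<nu> < a) sequentially"
      using ev[of e] by (auto elim!: eventually_mono)
  qed
qed

end

section \<open>Almost sure convergence for the Riemannian distance\<close>

theorem proposition3p16:
  fixes X :: "'a topology"
    and A :: "('a, 'n::finite) chart set"
    and g :: "('a, 'n) chart \<Rightarrow> real ^ 'n \<Rightarrow> real ^ 'n ^ 'n"
    and V :: "'a measure"
    and \<Omega> :: "'w measure"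
    and P :: "nat \<Rightarrow> 'w \<Rightarrow> 'a"
  assumes "riemannian_manifold X A g"
    and "compact_space X"
    and "connected_space X"
    and "is_riemannian_volume X A g V"
    and "prob_space \<Omega>"
    and "prob_space.indep_vars \<Omega> (\<lambda>_. borel_measure_space X) P {1..}"
    and "\<And>i. i \<ge> 1 \<Longrightarrow> distr \<Omega> (borel_measure_space X) (P i) = normalized_measure V"
  shows "AE \<omega> in \<Omega>.
    (\<lambda>N. kantorovich_dist (topspace X) (riemannian_dist X A g)
           (empirical_measure (borel_measure_space X) (\<lambda>i. P i \<omega>) N)
           (normalized_measure V)) \<longlonglongrightarrow> 0"
proof -
  interpret M: riemannian_manifold X A g by fact
  interpret \<Omega>: prob_space \<Omega> by fact
  let ?S = "borel_measure_space X" and ?d = "riemannian_dist X A g" and ?\<nu> = "normalized_measure V"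
  interpret D: locally_small_dist X ?d
    using M.riemannian_dist_nonneg[OF assms(3)] M.riemannian_dist_locally_small
    by unfold_locales
  have P: "P i \<in> measurable \<Omega> ?S" if "i \<ge> 1" for i
    using assms(6) that unfolding \<Omega>.indep_vars_def by auto
  \<comment> \<open>\<open>normalized_measure V\<close> is the law of \<open>P 1\<close>, hence a
    probability measure on the Borel sets.\<close>
  have \<nu>: "prob_space ?\<nu>" "sets ?\<nu> = sets ?S"
    using \<Omega>.prob_space_distr[OF P, of 1] assms(7)[of 1] by (auto simp flip: assms(7)[of 1])
  have "\<forall>k::nat. \<exists>m (B :: nat \<Rightarrow> 'a set). (\<Union>i<m. B i) = topspace X \<and> disjoint_family B \<and>
      (\<forall>i. B i \<in> sets ?S) \<and> (\<forall>i<m. \<forall>x\<in>B i. \<forall>y\<in>B i. ?d x y \<le> 1 / Suc k)"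
    by (intro allI D.finite_small_partition assms(2)) simp
  \<comment> \<open>The partitions for all \<open>k\<close> are fixed here, before any outcome
    \<omega> is considered; the strong law then holds for all the sets \<open>B k i\<close> off a
    single null set.\<close>
  then obtain m and B :: "nat \<Rightarrow> nat \<Rightarrow> 'a set" where B: "\<And>k. (\<Union>i<m k. B k i) = topspace X \<and> disjoint_family (B k) \<and>
      (\<forall>i. B k i \<in> sets ?S) \<and> (\<forall>i<m k. \<forall>x\<in>B k i. \<forall>y\<in>B k i. ?d x y \<le> 1 / Suc k)"
    by metis
  have "AE \<omega> in \<Omega>. \<forall>k i. (\<lambda>N. (\<Sum>j=1..N. indicator (B k i) (P j \<omega>)) / real N) \<longlonglongrightarrow> measure ?\<nu> (B k i)"
    unfolding AE_all_countable
    using B by (intro allI \<Omega>.strong_law_indicator[OF assms(6,7)]) auto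
  then show ?thesis
    using AE_space
  proof eventually_elim
    case (elim \<omega>)
    let ?\<mu> = "\<lambda>N. empirical_measure ?S (\<lambda>i. P i \<omega>) N"
    have p: "P i \<omega> \<in> space ?S" if "i \<in> {1..N}" for i N
      using P[of i] elim(2) that by (auto dest: measurable_space)
    have conv: "(\<lambda>N. measure (?\<mu> N) (B k i)) \<longlonglongrightarrow> measure ?\<nu> (B k i)" for k i
    proof -
      have "B k i \<in> sets ?S" using B by blast
      then have "measure (?\<mu> N) (B k i) = (\<Sum>j=1..N. indicator (B k i) (P j \<omega>)) / real N" for N
        using measure_empirical_measure[of N "\<lambda>i. P i \<omega>" ?S] p by blast
      then show ?thesis using elim(1) by presburger
    qed
    have "eventually (\<lambda>N. prob_space (?\<mu> N) \<and> sets (?\<mu> N) = sets ?S) sequentially"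
      using eventually_ge_at_top[of 1]
    proof eventually_elim
      case (elim N)
      then show ?case
        using prob_space_empirical_measure[of N "\<lambda>i. P i \<omega>" ?S]
          sets_empirical_measure[of N "\<lambda>i. P i \<omega>" ?S] p by blast
    qed
    then show ?case
      using \<nu>
    proof (rule D.kantorovich_dist_tendsto_0[OF assms(2,3)])
      fix k :: nat
      show "\<exists>m (B :: nat \<Rightarrow> 'a set). (\<Union>i<m. B i) = topspace X \<and> disjoint_family B \<and>
          (\<forall>i. B i \<in> sets ?S) \<and> (\<forall>i<m. \<forall>x\<in>B i. \<forall>y\<in>B i. ?d x y \<le> 1 / Suc k) \<and>
          (\<forall>i. (\<lambda>N. measure (?\<mu> N) (B i)) \<longlonglongrightarrow> measure ?\<nu> (B i))"
        using B[of k] conv[of _ k] conv by (intro exI[of _ "m k"] exI[of _ "B k"]) blast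
    qed
  qed
qed

end
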